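(* Every logic $L$ with $\mathsf{ETL}\le L\le\mathsf{CL}$ is either equal to one of $\mathsf{ETL}$, $\mathsf{K}$, $\mathsf{CL}$, or satisfies $\mathsf{ETL}_2\le L\le\mathsf{K}^-$. Moreover $\mathsf{ETL}<\mathsf{ETL}_2\le\mathsf{K}^-<\mathsf{K}<\mathsf{CL}$.
   Context: Formulas are built from a countably infinite set of variables using binary $\wedge,\vee$, unary ${\sim}$ and constants $\top,\bot$. A logic is a set of rules $\Gamma\vdash\varphi$ closed under reflexivity, monotonicity, cut and substitution; $L_1\le L_2$ means inclusion; the extension of $L$ by rules is the least logic containing both. For a matrix $\langle A,F\rangle$ (algebra with $F\subseteq A$), a rule is valid if every valuation sending the premises into $F$ sends the conclusion into $F$; $\mathrm{Log}$ denotes the set of valid rules. Let $\mathbf{DM}_4$ be the De Morgan algebra on $\{\bot,n,b,\top\}$ with $\bot<n,b<\top$, ${\sim}$ swapping $\top,\bot$ and fixing $n,b$. $\mathsf{ETL}=\mathrm{Log}\langle\mathbf{DM}_4,\{\top\}\rangle$; $\mathsf{K}=\mathrm{Log}$ of the submatrix on $\{\bot,n,\top\}$ with designated $\{\top\}$; $\mathsf{CL}=\mathrm{Log}$ of the submatrix on $\{\bot,\top\}$ with designated $\{\top\}$. $\mathsf{ETL}_2$ is the extension of $\mathsf{ETL}$ by the rule $(p\wedge{\sim}p)\vee(q\wedge{\sim}q)\vdash r$ (distinct variables). $\mathsf{K}^-$ is $\mathrm{Log}$ of the following eight-element matrix: let $P=\{u,v,u',v'\}$ be the poset whose only strict order relations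 are $u<u'$, $u<v'$, $v<u'$, with involution $\partial$ swapping $u\leftrightarrow u'$, $v\leftrightarrow v'$; the algebra consists of the upsets of $P$ with $\wedge=\cap$, $\vee=\cup$, $\bot=\emptyset$, $\top=P$, ${\sim}U=P\setminus\partial[U]$, and the designated set is $\{P\}$. *)

theory Defs
  imports Main
begin

text \<open>The variables are indexed by the natural numbers.\<close>

datatype fm =
    Var nat
  | Verum
  | Falsum
  | Neg fm
  | Conj fm fm
  | Disj fm fm

primrec subst :: "(nat \<Rightarrow> fm) \<Rightarrow> fm \<Rightarrow> fm" where
  "subst \<sigma> (Var x) = \<sigma> x"
| "subst \<sigma> Verum = Verum"
| "subst \<sigma> Falsum = Falsum"
| "subst \<sigma> (Neg \<phi>) = Neg (subst \<sigma> \<phi>)"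
| "subst \<sigma> (Conj \<phi> \<psi>) = Conj (subst \<sigma> \<phi>) (subst \<sigma> \<psi>)"
| "subst \<sigma> (Disj \<phi> \<psi>) = Disj (subst \<sigma> \<phi>) (subst \<sigma> \<psi>)"

text \<open>The pair \<open>(\<Gamma>, \<phi>)\<close> stands for the rule \<open>\<Gamma> \<turnstile> \<phi>\<close>; the set of premises may be
  infinite.\<close>

type_synonym rule = "fm set \<times> fm"

text \<open>Since premise sets may be infinite, cut eliminates an arbitrary set \<open>\<Delta>\<close> of
  intermediate conclusions at once.\<close>

definition is_logic :: "rule set \<Rightarrow> bool" where
  "is_logic L \<longleftrightarrow>
     (\<forall>\<phi>. ({\<phi>}, \<phi>) \<in> L) \<and>
     (\<forall>\<Gamma> \<Delta> \<phi>. (\<Gamma>, \<phi>) \<in> L \<longrightarrow> (\<Gamma> \<union> \<Delta>, \<phi>) \<in> L) \<and>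
     (\<forall>\<Gamma> \<Delta> \<phi>. (\<forall>\<delta>\<in>\<Delta>. (\<Gamma>, \<delta>) \<in> L) \<longrightarrow> (\<Gamma> \<union> \<Delta>, \<phi>) \<in> L \<longrightarrow> (\<Gamma>, \<phi>) \<in> L) \<and>
     (\<forall>\<sigma> \<Gamma> \<phi>. (\<Gamma>, \<phi>) \<in> L \<longrightarrow> (subst \<sigma> ` \<Gamma>, subst \<sigma> \<phi>) \<in> L)"

definition extension :: "rule set \<Rightarrow> rule set \<Rightarrow> rule set" where
  "extension L R = \<Inter> {L'. is_logic L' \<and> L \<subseteq> L' \<and> R \<subseteq> L'}"

lemma is_logic_refl: "is_logic L \<Longrightarrow> ({\<phi>}, \<phi>) \<in> L"
  unfolding is_logic_def by (elim conjE, erule spec)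

lemma is_logic_mono: "is_logic L \<Longrightarrow> (\<Gamma>, \<phi>) \<in> L \<Longrightarrow> (\<Gamma> \<union> \<Delta>, \<phi>) \<in> L"
  unfolding is_logic_def by (elim conjE, drule spec, drule spec, drule spec, erule mp)

lemma is_logic_cut:
  assumes "is_logic L" "\<And>\<delta>. \<delta> \<in> \<Delta> \<Longrightarrow> (\<Gamma>, \<delta>) \<in> L" "(\<Gamma> \<union> \<Delta>, \<phi>) \<in> L"
  shows "(\<Gamma>, \<phi>) \<in> L"
proof -
  have "(\<forall>\<delta>\<in>\<Delta>. (\<Gamma>, \<delta>) \<in> L) \<longrightarrow> (\<Gamma> \<union> \<Delta>, \<phi>) \<in> L \<longrightarrow> (\<Gamma>, \<phi>) \<in> L"
    using assms(1)[unfolded is_logic_def, THEN conjunct2, THEN conjunct2, THEN conjunct1]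
    by (elim allE)
  then show ?thesis
    using assms(2,3) by blast
qed

lemma is_logic_subst: "is_logic L \<Longrightarrow> (\<Gamma>, \<phi>) \<in> L \<Longrightarrow> (subst \<sigma> ` \<Gamma>, subst \<sigma> \<phi>) \<in> L"
  unfolding is_logic_def by (elim conjE) simp

lemma is_logicI:
  assumes "\<And>\<phi>. ({\<phi>}, \<phi>) \<in> L"
    and "\<And>\<Gamma> \<Delta> \<phi>. (\<Gamma>, \<phi>) \<in> L \<Longrightarrow> (\<Gamma> \<union> \<Delta>, \<phi>) \<in> L"
    and "\<And>\<Gamma> \<Delta> \<phi>. \<forall>\<delta>\<in>\<Delta>. (\<Gamma>, \<delta>) \<in> L \<Longrightarrow> (\<Gamma> \<union> \<Delta>, \<phi>) \<in> L \<Longrightarrow> (\<Gamma>, \<phi>) \<in> L"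
    and "\<And>\<sigma> \<Gamma> \<phi>. (\<Gamma>, \<phi>) \<in> L \<Longrightarrow> (subst \<sigma> ` \<Gamma>, subst \<sigma> \<phi>) \<in> L"
  shows "is_logic L"
  unfolding is_logic_def by (intro conjI allI impI; (fact assms(1) | erule assms(2) | erule (1) assms(3) | erule assms(4)))

lemma is_logic_Inter:
  assumes "\<And>L. L \<in> \<L> \<Longrightarrow> is_logic L"
  shows "is_logic (\<Inter> \<L>)"
proof (rule is_logicI; rule InterI)
  fix L \<phi> assume "L \<in> \<L>"
  then show "({\<phi>}, \<phi>) \<in> L"
    by (intro is_logic_refl assms)
next
  fix L \<Gamma> \<Delta> \<phi> assume "(\<Gamma>, \<phi>) \<in> \<Inter> \<L>" "L \<in> \<L>"
  then show "(\<Gamma> \<union> \<Delta>, \<phi>) \<in> L"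
    by (intro is_logic_mono assms) auto
next
  fix L \<Gamma> \<Delta> \<phi>
  assume *: "\<forall>\<delta>\<in>\<Delta>. (\<Gamma>, \<delta>) \<in> \<Inter> \<L>" "(\<Gamma> \<union> \<Delta>, \<phi>) \<in> \<Inter> \<L>" "L \<in> \<L>"
  show "(\<Gamma>, \<phi>) \<in> L"
    by (rule is_logic_cut[OF assms[OF *(3)], where \<Delta> = \<Delta>]) (use * in auto)
next
  fix L \<sigma> \<Gamma> \<phi> assume "(\<Gamma>, \<phi>) \<in> \<Inter> \<L>" "L \<in> \<L>"
  then show "(subst \<sigma> ` \<Gamma>, subst \<sigma> \<phi>) \<in> L"
    by (intro is_logic_subst assms) auto
qed

lemma is_logic_extension: "is_logic (extension L R)"
  unfolding extension_def by (rule is_logic_Inter) simp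

lemma extension_upper: "L \<subseteq> extension L R" "R \<subseteq> extension L R"
  unfolding extension_def by auto

lemma extension_least:
  assumes "is_logic L'" "L \<subseteq> L'" "R \<subseteq> L'"
  shows "extension L R \<subseteq> L'"
  unfolding extension_def using assms by auto

record 'a matrix =
  univ :: "'a set"
  meet :: "'a \<Rightarrow> 'a \<Rightarrow> 'a"
  join :: "'a \<Rightarrow> 'a \<Rightarrow> 'a"
  neg :: "'a \<Rightarrow> 'a"
  topel :: 'a
  botel :: 'a
  desig :: "'a set"

definition subuniverse :: "'a matrix \<Rightarrow> 'a set \<Rightarrow> bool" where
  "subuniverse M S \<longleftrightarrow> S \<subseteq> univ M \<and> topel M \<in> S \<and> botel M \<in> S \<and>
     (\<forall>x\<in>S. neg M x \<in> S) \<and> (\<forall>x\<in>S. \<forall>y\<in>S. meet M x y \<in> S \<and> join M x y \<in> S)"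

definition submatrix :: "'a matrix \<Rightarrow> 'a set \<Rightarrow> 'a matrix" where
  "submatrix M S = M\<lparr>univ := S, desig := desig M \<inter> S\<rparr>"

primrec eval :: "'a matrix \<Rightarrow> (nat \<Rightarrow> 'a) \<Rightarrow> fm \<Rightarrow> 'a" where
  "eval M v (Var x) = v x"
| "eval M v Verum = topel M"
| "eval M v Falsum = botel M"
| "eval M v (Neg \<phi>) = neg M (eval M v \<phi>)"
| "eval M v (Conj \<phi> \<psi>) = meet M (eval M v \<phi>) (eval M v \<psi>)"
| "eval M v (Disj \<phi> \<psi>) = join M (eval M v \<phi>) (eval M v \<psi>)"

definition valid_rule :: "'a matrix \<Rightarrow> rule \<Rightarrow> bool" where
  "valid_rule M r \<longleftrightarrow>
     (\<forall>v. range v \<subseteq> univ M \<longrightarrow> eval M v ` fst r \<subseteq> desig M \<longrightarrow> eval M v (snd r) \<in> desig M)"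

definition Log :: "'a matrix \<Rightarrow> rule set" where
  "Log M = {r. valid_rule M r}"

lemma eval_subst: "eval M v (subst \<sigma> \<phi>) = eval M (\<lambda>x. eval M v (\<sigma> x)) \<phi>"
  by (induction \<phi>) simp_all

lemma eval_in_univ:
  assumes "subuniverse M (univ M)" "range v \<subseteq> univ M"
  shows "eval M v \<phi> \<in> univ M"
  using assms by (induction \<phi>) (auto simp: subuniverse_def)

lemma is_logic_Log:
  assumes "subuniverse M (univ M)"
  shows "is_logic (Log M)"
proof -
  have cut: "(\<Gamma>, \<phi>) \<in> Log M"
    if 1: "\<forall>\<delta>\<in>\<Delta>. (\<Gamma>, \<delta>) \<in> Log M" and 2: "(\<Gamma> \<union> \<Delta>, \<phi>) \<in> Log M" for \<Gamma> \<Delta> \<phi>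
    unfolding Log_def valid_rule_def mem_Collect_eq fst_conv snd_conv
  proof (intro allI impI)
    fix v assume v: "range v \<subseteq> univ M" "eval M v ` \<Gamma> \<subseteq> desig M"
    have "eval M v ` (\<Gamma> \<union> \<Delta>) \<subseteq> desig M"
      using 1 v by (auto simp: Log_def valid_rule_def)
    then show "eval M v \<phi> \<in> desig M"
      using 2 v(1) by (simp add: Log_def valid_rule_def)
  qed
  have subst: "(subst \<sigma> ` \<Gamma>, subst \<sigma> \<phi>) \<in> Log M" if 1: "(\<Gamma>, \<phi>) \<in> Log M" for \<sigma> \<Gamma> \<phi>
    unfolding Log_def valid_rule_def mem_Collect_eq fst_conv snd_conv
  proof (intro allI impI)
    fix v assume v: "range v \<subseteq> univ M" "eval M v ` subst \<sigma> ` \<Gamma> \<subseteq> desig M"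
    have "range (\<lambda>x. eval M v (\<sigma> x)) \<subseteq> univ M"
      using eval_in_univ[OF assms v(1)] by auto
    then show "eval M v (subst \<sigma> \<phi>) \<in> desig M"
      using 1 v(2) by (simp add: Log_def valid_rule_def eval_subst image_image)
  qed
  have refl: "({\<phi>}, \<phi>) \<in> Log M" for \<phi>
    by (simp add: Log_def valid_rule_def)
  have mono: "(\<Gamma> \<union> \<Delta>, \<phi>) \<in> Log M" if "(\<Gamma>, \<phi>) \<in> Log M" for \<Gamma> \<Delta> \<phi>
    using that by (simp add: Log_def valid_rule_def image_Un)
  show ?thesis
    by (rule is_logicI) (fact refl, erule mono, erule (1) cut, erule subst)
qed

datatype dm4 = Bot4 | N4 | B4 | Top4

instantiation dm4 :: "{distrib_lattice, bounded_lattice}"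
begin

definition less_eq_dm4 :: "dm4 \<Rightarrow> dm4 \<Rightarrow> bool" where
  "x \<le> y \<longleftrightarrow> x = Bot4 \<or> y = Top4 \<or> x = y"

definition less_dm4 :: "dm4 \<Rightarrow> dm4 \<Rightarrow> bool" where
  "(x :: dm4) < y \<longleftrightarrow> x \<le> y \<and> x \<noteq> y"

definition inf_dm4 :: "dm4 \<Rightarrow> dm4 \<Rightarrow> dm4" where
  "inf x y = (if x \<le> y then x else if y \<le> x then y else Bot4)"

definition sup_dm4 :: "dm4 \<Rightarrow> dm4 \<Rightarrow> dm4" where
  "sup x y = (if x \<le> y then y else if y \<le> x then x else Top4)"

definition top_dm4 :: dm4 where "top = Top4"

definition bot_dm4 :: dm4 where "bot = Bot4"

instance
proof
  fix x y z :: dm4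
  show "sup x (inf y z) = inf (sup x y) (sup x z)"
    by (cases x; cases y; cases z)
      (simp_all add: less_eq_dm4_def inf_dm4_def sup_dm4_def)
qed (auto simp: less_eq_dm4_def less_dm4_def inf_dm4_def sup_dm4_def top_dm4_def bot_dm4_def
      split: if_splits)

end

primrec dm4_neg :: "dm4 \<Rightarrow> dm4" where
  "dm4_neg Bot4 = Top4"
| "dm4_neg N4 = N4"
| "dm4_neg B4 = B4"
| "dm4_neg Top4 = Bot4"

definition DM4_matrix :: "dm4 matrix" where
  "DM4_matrix = \<lparr>univ = UNIV, meet = inf, join = sup, neg = dm4_neg,
     topel = top, botel = bot, desig = {top}\<rparr>"

definition ETL :: "rule set" where
  "ETL = Log DM4_matrix"

definition K :: "rule set" where
  "K = Log (submatrix DM4_matrix {Bot4, N4, Top4})"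

definition CL :: "rule set" where
  "CL = Log (submatrix DM4_matrix {Bot4, Top4})"

lemma subuniverse_DM4:
  "subuniverse DM4_matrix UNIV"
  "subuniverse DM4_matrix {Bot4, N4, Top4}"
  "subuniverse DM4_matrix {Bot4, Top4}"
  by (auto simp: subuniverse_def DM4_matrix_def less_eq_dm4_def inf_dm4_def sup_dm4_def
      top_dm4_def bot_dm4_def)

definition ETL2 :: "rule set" where
  "ETL2 = extension ETL
     {({Disj (Conj (Var 0) (Neg (Var 0))) (Conj (Var 1) (Neg (Var 1)))}, Var 2)}"

datatype pt = U | V | U' | V'

definition pt_less :: "pt \<Rightarrow> pt \<Rightarrow> bool" where
  "pt_less x y \<longleftrightarrow> (x, y) \<in> {(U, U'), (U, V'), (V, U')}"

primrec pt_inv :: "pt \<Rightarrow> pt" where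
  "pt_inv U = U'"
| "pt_inv U' = U"
| "pt_inv V = V'"
| "pt_inv V' = V"

definition pt_upset :: "pt set \<Rightarrow> bool" where
  "pt_upset X \<longleftrightarrow> (\<forall>x\<in>X. \<forall>y. pt_less x y \<longrightarrow> y \<in> X)"

definition K_minus_matrix :: "pt set matrix" where
  "K_minus_matrix = \<lparr>univ = {X. pt_upset X}, meet = (\<inter>), join = (\<union>),
     neg = (\<lambda>X. UNIV - pt_inv ` X), topel = UNIV, botel = {}, desig = {UNIV}\<rparr>"

lemma subuniverse_K_minus: "subuniverse K_minus_matrix (univ K_minus_matrix)"
proof -
  have "pt_upset (UNIV - pt_inv ` X)" if X: "pt_upset X" for X
    unfolding pt_upset_def
  proof (intro ballI allI impI)
    fix x y assume x: "x \<in> UNIV - pt_inv ` X" and xy: "pt_less x y"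
    have "pt_less (pt_inv y) (pt_inv x)"
      using xy by (auto simp: pt_less_def)
    moreover have "pt_inv (pt_inv z) = z" for z
      by (cases z) simp_all
    ultimately show "y \<in> UNIV - pt_inv ` X"
      using x X unfolding pt_upset_def by (metis DiffD2 DiffI UNIV_I imageE imageI)
  qed
  then show ?thesis
    by (auto simp: subuniverse_def K_minus_matrix_def pt_upset_def)
qed

definition K_minus :: "rule set" where
  "K_minus = Log K_minus_matrix"

end

theory Submission
  imports Defs
begin

text \<open>
  Everything is reduced to valuations in the four-element algebra. Substituting two variables
  for \<open>n\<close> and \<open>b\<close> in a rule that fails there turns it into
  \<open>(p \<and> \<sim>p) \<or> (q \<and> \<sim>q) \<turnstile> r\<close>, because the premise of the latter is exactly true only if
  \<open>{p, q} = {n, b}\<close>. Substituting one variable for \<open>n\<close> in a rule that fails in \<open>K\<close> yields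
  excluded middle, because exact truth under \<open>p = n\<close> and \<open>p = b\<close> persists to every value of
  \<open>p\<close> along the information order \<open>n \<sqsubseteq> \<bottom>, \<top> \<sqsubseteq> b\<close>.

  The eight-element algebra is a subdirect product of the three- and the four-element one, the
  factors being read off from the points \<open>u, u'\<close> and \<open>v, v'\<close>. It has a single element other
  than the top that is mapped to the top of the three-element factor, so a rule valid in \<open>K\<close>
  that fails in the eight-element matrix takes this value at its conclusion. Naming the elements
  by formulas in \<open>p, q\<close> then yields \<open>(p \<and> \<sim>p) \<or> q \<turnstile> q\<close>, and this rule axiomatizes \<open>K\<close>
  over \<open>ETL\<close>: a theory closed under it is separated from any formula outside it by a prime
  filter that contains no formula together with its negation, that is, by a three-valued
  valuation.
\<close>

section \<open>Valuations in the four-element algebra\<close>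

abbreviation ev :: "(nat \<Rightarrow> dm4) \<Rightarrow> fm \<Rightarrow> dm4" where
  "ev \<equiv> eval DM4_matrix"

lemma DM4_matrix_simps [simp]:
  "univ DM4_matrix = UNIV" "desig DM4_matrix = {Top4}"
  "topel DM4_matrix = Top4" "botel DM4_matrix = Bot4"
  "neg DM4_matrix = dm4_neg" "meet DM4_matrix = inf" "join DM4_matrix = sup"
  by (simp_all add: DM4_matrix_def top_dm4_def bot_dm4_def)

lemma ev_simps:
  "ev v Verum = Top4"
  "ev v Falsum = Bot4"
  "ev v (Neg \<phi>) = dm4_neg (ev v \<phi>)"
  "ev v (Conj \<phi> \<psi>) = inf (ev v \<phi>) (ev v \<psi>)"
  "ev v (Disj \<phi> \<psi>) = sup (ev v \<phi>) (ev v \<psi>)"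
  by simp_all

lemmas dm4_ops = less_eq_dm4_def inf_dm4_def sup_dm4_def top_dm4_def bot_dm4_def

lemma eval_submatrix: "eval (submatrix M S) v \<phi> = eval M v \<phi>"
  by (induction \<phi>) (simp_all add: submatrix_def)

lemma ETL_iff: "(\<Gamma>, \<phi>) \<in> ETL \<longleftrightarrow> (\<forall>v. (\<forall>\<gamma>\<in>\<Gamma>. ev v \<gamma> = Top4) \<longrightarrow> ev v \<phi> = Top4)"
  by (auto simp: ETL_def Log_def valid_rule_def image_subset_iff)

lemma K_iff:
  "(\<Gamma>, \<phi>) \<in> K \<longleftrightarrow>
     (\<forall>v. (\<forall>x. v x \<noteq> B4) \<longrightarrow> (\<forall>\<gamma>\<in>\<Gamma>. ev v \<gamma> = Top4) \<longrightarrow> ev v \<phi> = Top4)"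
proof -
  have "d \<in> {Bot4, N4, Top4} \<longleftrightarrow> d \<noteq> B4" for d
    by (cases d) simp_all
  then have "range v \<subseteq> {Bot4, N4, Top4} \<longleftrightarrow> (\<forall>x. v x \<noteq> B4)" for v :: "nat \<Rightarrow> dm4"
    by (simp only: image_subset_iff) simp
  moreover have "univ (submatrix DM4_matrix {Bot4, N4, Top4}) = {Bot4, N4, Top4}"
    "desig (submatrix DM4_matrix {Bot4, N4, Top4}) = {Top4}"
    by (simp_all add: submatrix_def)
  ultimately show ?thesis
    by (simp add: K_def Log_def valid_rule_def eval_submatrix image_subset_iff)
qed

lemma CL_iff:
  "(\<Gamma>, \<phi>) \<in> CL \<longleftrightarrow>
     (\<forall>v. (\<forall>x. v x \<in> {Bot4, Top4}) \<longrightarrow> (\<forall>\<gamma>\<in>\<Gamma>. ev v \<gamma> = Top4) \<longrightarrow> ev v \<phi> = Top4)"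
proof -
  have "univ (submatrix DM4_matrix {Bot4, Top4}) = {Bot4, Top4}"
    "desig (submatrix DM4_matrix {Bot4, Top4}) = {Top4}"
    by (simp_all add: submatrix_def)
  then show ?thesis
    by (simp add: CL_def Log_def valid_rule_def eval_submatrix image_subset_iff)
qed

lemma K_minus_matrix_simps [simp]:
  "univ K_minus_matrix = {X. pt_upset X}" "desig K_minus_matrix = {UNIV}"
  "topel K_minus_matrix = UNIV" "botel K_minus_matrix = {}"
  "neg K_minus_matrix X = UNIV - pt_inv ` X"
  "meet K_minus_matrix = (\<inter>)" "join K_minus_matrix = (\<union>)"
  by (simp_all add: K_minus_matrix_def)

lemma K_minus_iff:
  "(\<Gamma>, \<phi>) \<in> K_minus \<longleftrightarrow>
     (\<forall>w. (\<forall>x. pt_upset (w x)) \<longrightarrow> (\<forall>\<gamma>\<in>\<Gamma>. eval K_minus_matrix w \<gamma> = UNIV) \<longrightarrow>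
        eval K_minus_matrix w \<phi> = UNIV)"
  by (simp add: K_minus_def Log_def valid_rule_def image_subset_iff)

lemma K_subset_CL: "K \<subseteq> CL"
proof (clarsimp simp only: K_iff CL_iff subset_iff split_paired_all)
  fix \<Gamma> \<phi> and v :: "nat \<Rightarrow> dm4"
  assume *: "\<forall>v. (\<forall>x. v x \<noteq> B4) \<longrightarrow> (\<forall>\<gamma>\<in>\<Gamma>. ev v \<gamma> = Top4) \<longrightarrow> ev v \<phi> = Top4"
    and v: "\<forall>x. v x \<in> {Bot4, Top4}" and "\<forall>\<gamma>\<in>\<Gamma>. ev v \<gamma> = Top4"
  moreover have "v x \<noteq> B4" for x
    using v[THEN spec, of x] by auto
  ultimately show "ev v \<phi> = Top4"
    by blast
qed

section \<open>The automorphism exchanging \<open>n\<close> and \<open>b\<close>, and the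
  information order\<close>

primrec dm4_swap :: "dm4 \<Rightarrow> dm4" where
  "dm4_swap Bot4 = Bot4"
| "dm4_swap N4 = B4"
| "dm4_swap B4 = N4"
| "dm4_swap Top4 = Top4"

lemma ev_swap: "ev (\<lambda>x. dm4_swap (v x)) \<phi> = dm4_swap (ev v \<phi>)"
proof -
  have "dm4_swap (inf x y) = inf (dm4_swap x) (dm4_swap y)"
    "dm4_swap (sup x y) = sup (dm4_swap x) (dm4_swap y)"
    "dm4_swap (dm4_neg x) = dm4_neg (dm4_swap x)" for x y
    by (cases x; cases y; simp add: dm4_ops)+
  then show ?thesis
    by (induction \<phi>) (simp_all add: ev_simps)
qed

lemma dm4_swap_eq_Top4: "dm4_swap x = Top4 \<longleftrightarrow> x = Top4" "Top4 = dm4_swap x \<longleftrightarrow> x = Top4"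
  by (cases x; simp)+

definition info_le :: "dm4 \<Rightarrow> dm4 \<Rightarrow> bool" where
  "info_le x y \<longleftrightarrow> x = N4 \<or> y = B4 \<or> x = y"

text \<open>Negation reverses the truth order but preserves the information order, as meet and join
  do.\<close>

lemma ev_info_mono:
  assumes "\<And>x. info_le (v x) (v' x)"
  shows "info_le (ev v \<phi>) (ev v' \<phi>)"
proof -
  have "info_le (inf x y) (inf x' y')" "info_le (sup x y) (sup x' y')"
    "info_le (dm4_neg x) (dm4_neg x')"
    if "info_le x x'" "info_le y y'" for x y x' y'
    using that by (cases x; cases x'; cases y; cases y'; simp add: dm4_ops info_le_def)+
  moreover have "info_le x x" for x
    by (simp add: info_le_def)
  ultimately show ?thesis
    using assms by (induction \<phi>) (simp_all add: ev_simps)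
qed

text \<open>The value under \<open>v'\<close> is squeezed in the information order between
  \<open>Top4\<close> and \<open>dm4_swap Top4\<close>, which is again \<open>Top4\<close>.\<close>

lemma ev_Top4_between:
  assumes "\<And>x. info_le (v x) (v' x)" "\<And>x. info_le (v' x) (dm4_swap (v x))"
    and "ev v \<phi> = Top4"
  shows "ev v' \<phi> = Top4"
proof -
  have "info_le (ev v \<phi>) (ev v' \<phi>)" "info_le (ev v' \<phi>) (dm4_swap (ev v \<phi>))"
    using ev_info_mono[of v v' \<phi>] ev_info_mono[of v' "\<lambda>x. dm4_swap (v x)" \<phi>] assms(1,2)
    by (simp_all add: ev_swap)
  then show ?thesis
    using assms(3) by (cases "ev v' \<phi>") (simp_all add: info_le_def)
qed

section \<open>Rules forced in extensions of \<open>ETL\<close>\<close>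

lemma logic_derive:
  assumes "is_logic L" "M \<subseteq> L" "\<And>\<delta>. \<delta> \<in> \<Delta> \<Longrightarrow> (\<Gamma>, \<delta>) \<in> L" "(\<Delta>, \<phi>) \<in> M"
  shows "(\<Gamma>, \<phi>) \<in> L"
proof (rule is_logic_cut[OF assms(1)])
  show "(\<Gamma> \<union> \<Delta>, \<phi>) \<in> L"
    using is_logic_mono[OF assms(1), of \<Delta> \<phi> \<Gamma>] assms(2,4) by (auto simp: Un_commute)
qed (fact assms(3))

text \<open>The scheme by which rules are forced: one substitution instance of a known rule of
  \<open>L\<close>, with \<open>ETL\<close> supplying its premises and drawing the final conclusion.
  Both side conditions are checks in the four-element algebra.\<close>

lemma logic_derive_subst:
  assumes "is_logic L" "ETL \<subseteq> L" "(\<Gamma>, \<phi>) \<in> L"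
    and prems: "\<And>\<gamma>. \<gamma> \<in> \<Gamma> \<Longrightarrow> (\<Delta>, subst \<sigma> \<gamma>) \<in> ETL"
    and concl: "(insert (subst \<sigma> \<phi>) \<Delta>, \<psi>) \<in> ETL"
  shows "(\<Delta>, \<psi>) \<in> L"
proof -
  have "(\<Delta>, subst \<sigma> \<phi>) \<in> L"
    using logic_derive[OF assms(1) subset_refl _ is_logic_subst[OF assms(1,3)]] prems assms(2)
    by blast
  moreover have "(\<Delta>, \<delta>) \<in> L" if "\<delta> \<in> \<Delta>" for \<delta>
    using that assms(2) by (auto simp: ETL_iff subset_iff)
  ultimately show ?thesis
    using logic_derive[OF assms(1,2) _ concl] by blast
qed

definition explosion2 :: rule where
  "explosion2 =
     ({Disj (Conj (Var 0) (Neg (Var 0))) (Conj (Var 1) (Neg (Var 1)))}, Var 2)"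

definition contradiction_elim :: rule where
  "contradiction_elim = ({Disj (Conj (Var 0) (Neg (Var 0))) (Var 1)}, Var 1)"

definition excluded_middle :: rule where
  "excluded_middle = ({}, Disj (Var 0) (Neg (Var 0)))"

lemma explosion2_if_not_subset_ETL:
  assumes L: "is_logic L" "ETL \<subseteq> L" and "\<not> L \<subseteq> ETL"
  shows "explosion2 \<in> L"
proof -
  obtain \<Gamma> \<phi> where r: "(\<Gamma>, \<phi>) \<in> L" "(\<Gamma>, \<phi>) \<notin> ETL"
    using assms(3) by auto
  then obtain v where v: "\<And>\<gamma>. \<gamma> \<in> \<Gamma> \<Longrightarrow> ev v \<gamma> = Top4" "ev v \<phi> \<noteq> Top4"
    by (auto simp: ETL_iff)
  define rep where "rep = case_dm4 Falsum (Var 0) (Var 1) Verum"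
  define \<sigma> where "\<sigma> = (\<lambda>x. rep (v x))"
  \<comment> \<open>The premise does not tell \<open>n\<close> from \<open>b\<close>, so the
    instance is evaluated as under \<open>v\<close> only up to \<open>dm4_swap\<close>.\<close>
  have ev_subst: "ev g (subst \<sigma> \<psi>) \<in> {ev v \<psi>, dm4_swap (ev v \<psi>)}"
    if g: "ev g (Disj (Conj (Var 0) (Neg (Var 0))) (Conj (Var 1) (Neg (Var 1)))) = Top4" for g \<psi>
  proof -
    have "g 0 = N4 \<and> g 1 = B4 \<or> g 0 = B4 \<and> g 1 = N4"
      using g by (cases "g 0"; cases "g 1") (simp_all add: ev_simps dm4_ops)
    then have "(\<forall>d. ev g (rep d) = d) \<or> (\<forall>d. ev g (rep d) = dm4_swap d)"
      by (auto simp: rep_def ev_simps split: dm4.splits)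
    then show ?thesis
      by (auto simp: eval_subst \<sigma>_def ev_swap)
  qed
  show ?thesis
    unfolding explosion2_def
  proof (rule logic_derive_subst[OF L r(1), where \<sigma> = \<sigma>])
    fix \<gamma> assume "\<gamma> \<in> \<Gamma>"
    with v(1) ev_subst[of _ \<gamma>]
    show "({Disj (Conj (Var 0) (Neg (Var 0))) (Conj (Var 1) (Neg (Var 1)))}, subst \<sigma> \<gamma>) \<in> ETL"
      by (fastforce simp: ETL_iff)
  next
    \<comment> \<open>The two premises are never exactly true together, so any conclusion
      follows.\<close>
    show "({subst \<sigma> \<phi>, Disj (Conj (Var 0) (Neg (Var 0))) (Conj (Var 1) (Neg (Var 1)))}, Var 2)
      \<in> ETL"
      unfolding ETL_iff using v(2) ev_subst[of _ \<phi>] by (metis dm4_swap_eq_Top4(1) insert_iff empty_iff)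
  qed
qed

lemma excluded_middle_if_not_subset_K:
  assumes L: "is_logic L" "ETL \<subseteq> L" and "\<not> L \<subseteq> K"
  shows "excluded_middle \<in> L"
proof -
  obtain \<Gamma> \<phi> where r: "(\<Gamma>, \<phi>) \<in> L" "(\<Gamma>, \<phi>) \<notin> K"
    using assms(3) by auto
  then obtain v where v: "\<And>x. v x \<noteq> B4" "\<And>\<gamma>. \<gamma> \<in> \<Gamma> \<Longrightarrow> ev v \<gamma> = Top4" "ev v \<phi> \<noteq> Top4"
    by (auto simp: K_iff)
  \<comment> \<open>Since \<open>v\<close> avoids \<open>B4\<close>, its entry \<open>Falsum\<close>
    is a placeholder.\<close>
  define rep where "rep = case_dm4 Falsum (Var 0) Falsum Verum"
  define \<sigma> where "\<sigma> = (\<lambda>x. rep (v x))"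
  show ?thesis
    unfolding excluded_middle_def
  proof (rule logic_derive_subst[OF L r(1), where \<sigma> = \<sigma>])
    fix \<gamma> assume "\<gamma> \<in> \<Gamma>"
    \<comment> \<open>Here \<open>g\<close> is arbitrary: \<open>Var 0\<close> stands only where
      \<open>v\<close> has the value \<open>N4\<close>, and every value lies between
      \<open>N4\<close> and \<open>B4\<close>.\<close>
    have "ev g (subst \<sigma> \<gamma>) = Top4" for g
      unfolding eval_subst
    proof (rule ev_Top4_between[where v = v])
      fix x
      show "info_le (v x) (ev g (\<sigma> x))" "info_le (ev g (\<sigma> x)) (dm4_swap (v x))"
        using v(1)[of x]
        by (cases "v x"; simp add: \<sigma>_def rep_def info_le_def ev_simps)+
    qed (fact v(2)[OF \<open>\<gamma> \<in> \<Gamma>\<close>])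
    then show "({}, subst \<sigma> \<gamma>) \<in> ETL"
      by (simp add: ETL_iff)
  next
    \<comment> \<open>If \<open>g 0\<close> is a fixed point of negation, the instance is evaluated
      as under \<open>v\<close> or its swap, hence not as \<open>Top4\<close>. Its exact truth
      therefore makes \<open>g 0\<close> classical.\<close>
    have "ev g (Disj (Var 0) (Neg (Var 0))) = Top4" if g: "ev g (subst \<sigma> \<phi>) = Top4" for g
    proof (rule ccontr)
      assume "ev g (Disj (Var 0) (Neg (Var 0))) \<noteq> Top4"
      then have "g 0 = N4 \<or> g 0 = B4"
        by (cases "g 0") (simp_all add: ev_simps dm4_ops)
      then have "(\<forall>d. d \<noteq> B4 \<longrightarrow> ev g (rep d) = d) \<or> (\<forall>d. d \<noteq> B4 \<longrightarrow> ev g (rep d) = dm4_swap d)"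
        by (auto simp: rep_def ev_simps split: dm4.splits)
      then have "(\<lambda>x. ev g (\<sigma> x)) = v \<or> (\<lambda>x. ev g (\<sigma> x)) = (\<lambda>x. dm4_swap (v x))"
        using v(1) by (auto simp: \<sigma>_def)
      then have "ev g (subst \<sigma> \<phi>) \<in> {ev v \<phi>, dm4_swap (ev v \<phi>)}"
        by (auto simp: eval_subst ev_swap)
      then show False
        using g v(3) by (auto simp: dm4_swap_eq_Top4)
    qed
    then show "({subst \<sigma> \<phi>}, Disj (Var 0) (Neg (Var 0))) \<in> ETL"
      by (auto simp: ETL_iff)
  qed
qed

text \<open>Excluded middle makes the value of \<open>Var 0\<close> classical. Its contradiction is
  then \<open>Bot4\<close>, and the disjunction reduces to \<open>Var 1\<close>.\<close>

lemma contradiction_elim_if_excluded_middle: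
  assumes L: "is_logic L" "ETL \<subseteq> L" and "excluded_middle \<in> L"
  shows "contradiction_elim \<in> L"
  unfolding contradiction_elim_def
proof (rule logic_derive_subst[OF L assms(3)[unfolded excluded_middle_def], where \<sigma> = Var])
  have "g 1 = Top4"
    if "ev g (Disj (Var 0) (Neg (Var 0))) = Top4"
      "ev g (Disj (Conj (Var 0) (Neg (Var 0))) (Var 1)) = Top4" for g
    using that by (cases "g 0"; cases "g 1") (simp_all add: ev_simps dm4_ops)
  then show "({subst Var (Disj (Var 0) (Neg (Var 0))),
      Disj (Conj (Var 0) (Neg (Var 0))) (Var 1)}, Var 1) \<in> ETL"
    by (simp add: ETL_iff)
qed simp

text \<open>Adding excluded middle for every variable to the premises leaves only two-valued
  valuations, so a classical rule becomes a rule of \<open>K\<close>. Cut removes these infinitely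
  many premises.\<close>

lemma CL_subset_if_excluded_middle:
  assumes L: "is_logic L" "K \<subseteq> L" and em: "excluded_middle \<in> L"
  shows "CL \<subseteq> L"
proof (clarify)
  fix \<Gamma> \<phi> assume r: "(\<Gamma>, \<phi>) \<in> CL"
  let ?em = "\<lambda>x. Disj (Var x) (Neg (Var x))"
  have "({}, ?em x) \<in> L" for x
    using is_logic_subst[OF L(1) em[unfolded excluded_middle_def], of "\<lambda>_. Var x"] by simp
  then have "(\<Gamma>, ?em x) \<in> L" for x
    using is_logic_mono[OF L(1), of "{}" _ \<Gamma>] by simp
  moreover have "(\<Gamma>, \<gamma>) \<in> L" if "\<gamma> \<in> \<Gamma>" for \<gamma>
    using that L(2) by (auto simp: K_iff subset_iff)
  moreover have "(\<Gamma> \<union> range ?em, \<phi>) \<in> K"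
    unfolding K_iff
  proof (intro allI impI)
    fix v assume v: "\<forall>\<gamma>\<in>\<Gamma> \<union> range ?em. ev v \<gamma> = Top4"
    have "v x \<in> {Bot4, Top4}" for x
    proof -
      have "ev v (?em x) = Top4"
        using v by blast
      then show ?thesis
        by (cases "v x") (simp_all add: ev_simps dm4_ops)
    qed
    then show "ev v \<phi> = Top4"
      using r v by (simp add: CL_iff)
  qed
  ultimately show "(\<Gamma>, \<phi>) \<in> L"
    using logic_derive[OF L, of "\<Gamma> \<union> range ?em" \<Gamma> \<phi>] by blast
qed

section \<open>Axiomatization of \<open>K\<close> over \<open>ETL\<close>\<close>

text \<open>This preorder replaces passing to the Lindenbaum algebra: its filters and ideals are
  handled as sets of formulas. The empty set counts as both.\<close>

definition fm_le :: "fm \<Rightarrow> fm \<Rightarrow> bool" where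
  "fm_le \<phi> \<psi> \<longleftrightarrow> (\<forall>v. ev v \<phi> \<le> ev v \<psi>)"

definition fm_filter :: "fm set \<Rightarrow> bool" where
  "fm_filter F \<longleftrightarrow> (\<forall>\<phi>\<in>F. \<forall>\<psi>. fm_le \<phi> \<psi> \<longrightarrow> \<psi> \<in> F) \<and> (\<forall>\<phi>\<in>F. \<forall>\<psi>\<in>F. Conj \<phi> \<psi> \<in> F)"

definition fm_ideal :: "fm set \<Rightarrow> bool" where
  "fm_ideal I \<longleftrightarrow> (\<forall>\<phi>\<in>I. \<forall>\<psi>. fm_le \<psi> \<phi> \<longrightarrow> \<psi> \<in> I) \<and> (\<forall>\<phi>\<in>I. \<forall>\<psi>\<in>I. Disj \<phi> \<psi> \<in> I)"

lemma fm_filter_Conj_iff: "fm_filter F \<Longrightarrow> Conj \<phi> \<psi> \<in> F \<longleftrightarrow> \<phi> \<in> F \<and> \<psi> \<in> F"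
proof -
  assume F: "fm_filter F"
  have "fm_le (Conj \<phi> \<psi>) \<phi>" "fm_le (Conj \<phi> \<psi>) \<psi>"
    by (simp_all add: fm_le_def)
  with F show ?thesis
    unfolding fm_filter_def by blast
qed

lemma fm_filter_mono: "fm_filter F \<Longrightarrow> \<phi> \<in> F \<Longrightarrow> fm_le \<phi> \<psi> \<Longrightarrow> \<psi> \<in> F"
  by (auto simp: fm_filter_def)

lemma inf_inf_le:
  fixes a b c x :: "'a::lattice"
  shows "inf a c \<le> x \<Longrightarrow> inf (inf a b) c \<le> x" "inf b c \<le> x \<Longrightarrow> inf (inf a b) c \<le> x"
  by (erule order_trans[rotated], rule inf_mono, simp_all)+

text \<open>The prime filter theorem for distributive lattices: a filter maximal among those that
  contain \<open>T\<close> and avoid \<open>I\<close> is prime.\<close>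

lemma prime_filter_separation:
  assumes T: "fm_filter T" "T \<noteq> {}" and I: "fm_ideal I" and disj: "T \<inter> I = {}"
  obtains F where "fm_filter F" "T \<subseteq> F" "F \<inter> I = {}"
    "\<And>\<phi> \<psi>. Disj \<phi> \<psi> \<in> F \<Longrightarrow> \<phi> \<in> F \<or> \<psi> \<in> F"
proof -
  define A where "A = {F. fm_filter F \<and> T \<subseteq> F \<and> F \<inter> I = {}}"
  have "\<exists>F\<in>A. \<forall>X\<in>A. F \<subseteq> X \<longrightarrow> X = F"
  proof (rule subset_Zorn_nonempty)
    show "A \<noteq> {}"
      using T disj by (auto simp: A_def)
  next
    fix C assume C: "C \<noteq> {}" "subset.chain A C"
    then have CA: "\<And>X. X \<in> C \<Longrightarrow> fm_filter X \<and> T \<subseteq> X \<and> X \<inter> I = {}"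
      by (auto simp: A_def subset.chain_def)
    have "fm_filter (\<Union>C)"
      unfolding fm_filter_def
    proof (intro conjI ballI allI impI)
      fix \<phi> \<psi> assume "\<phi> \<in> \<Union>C" "fm_le \<phi> \<psi>"
      then show "\<psi> \<in> \<Union>C"
        using CA fm_filter_mono by blast
    next
      fix \<phi> \<psi> assume "\<phi> \<in> \<Union>C" "\<psi> \<in> \<Union>C"
      then obtain X Y where XY: "X \<in> C" "Y \<in> C" "\<phi> \<in> X" "\<psi> \<in> Y"
        by blast
      then have "X \<subseteq> Y \<or> Y \<subseteq> X"
        using C(2) by (auto simp: subset.chain_def)
      then show "Conj \<phi> \<psi> \<in> \<Union>C"
        using XY CA fm_filter_Conj_iff by (metis Union_iff subsetD)
    qed
    then show "\<Union>C \<in> A"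
      using CA C(1) by (auto simp: A_def)
  qed
  then obtain F where FA: "F \<in> A" and max: "\<And>X. X \<in> A \<Longrightarrow> F \<subseteq> X \<Longrightarrow> X = F"
    by blast
  then have F: "fm_filter F" "T \<subseteq> F" "F \<inter> I = {}"
    by (auto simp: A_def)
  \<comment> \<open>By maximality, the filter \<open>G\<close> generated by \<open>F\<close> and
    \<phi> has to meet \<open>I\<close>.\<close>
  have meets: "\<exists>f\<in>F. \<exists>i\<in>I. fm_le (Conj f \<phi>) i" if "\<phi> \<notin> F" for \<phi>
  proof (rule ccontr)
    assume none: "\<not> ?thesis"
    define G where "G = {\<psi>. \<exists>f\<in>F. fm_le (Conj f \<phi>) \<psi>}"
    have "fm_filter G"
      unfolding fm_filter_def
    proof (intro conjI ballI allI impI)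
      fix \<psi> \<chi> assume "\<psi> \<in> G" "fm_le \<psi> \<chi>"
      then show "\<chi> \<in> G"
        unfolding G_def fm_le_def using order_trans by blast
    next
      fix \<psi> \<chi> assume "\<psi> \<in> G" "\<chi> \<in> G"
      then obtain f g where fg: "f \<in> F" "g \<in> F" "fm_le (Conj f \<phi>) \<psi>" "fm_le (Conj g \<phi>) \<chi>"
        by (auto simp: G_def)
      have "fm_le (Conj (Conj f g) \<phi>) (Conj \<psi> \<chi>)"
        unfolding fm_le_def ev_simps
      proof
        fix v
        have "inf (ev v f) (ev v \<phi>) \<le> ev v \<psi>" "inf (ev v g) (ev v \<phi>) \<le> ev v \<chi>"
          using fg(3,4) by (simp_all add: fm_le_def)
        then show "inf (inf (ev v f) (ev v g)) (ev v \<phi>) \<le> inf (ev v \<psi>) (ev v \<chi>)"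
          by (intro le_infI) (erule inf_inf_le)+
      qed
      then show "Conj \<psi> \<chi> \<in> G"
        using fg F(1) by (auto simp: G_def fm_filter_Conj_iff)
    qed
    moreover have "F \<subseteq> G"
      unfolding G_def fm_le_def ev_simps using inf_le1 by blast
    moreover have "G \<inter> I = {}"
      using none by (auto simp: G_def)
    ultimately have "G = F"
      using max F(2) by (auto simp: A_def)
    moreover have "\<phi> \<in> G"
      using T(2) F(2) by (auto simp: G_def fm_le_def ev_simps)
    ultimately show False
      using that by simp
  qed
  \<comment> \<open>If both disjuncts were outside \<open>F\<close>, distributivity would put a join
    of two members of \<open>I\<close> into \<open>F\<close>.\<close>
  have "\<phi> \<in> F \<or> \<psi> \<in> F" if D: "Disj \<phi> \<psi> \<in> F" for \<phi> \<psi>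
  proof (rule ccontr)
    assume "\<not> ?thesis"
    then obtain f g i j where fg: "f \<in> F" "g \<in> F" "i \<in> I" "j \<in> I"
      and le: "fm_le (Conj f \<phi>) i" "fm_le (Conj g \<psi>) j"
      using meets by meson
    have "fm_le (Conj (Conj f g) (Disj \<phi> \<psi>)) (Disj i j)"
      unfolding fm_le_def ev_simps
    proof
      fix v
      have "inf (ev v f) (ev v \<phi>) \<le> ev v i" "inf (ev v g) (ev v \<psi>) \<le> ev v j"
        using le by (simp_all add: fm_le_def ev_simps)
      then have "inf (inf (ev v f) (ev v g)) (ev v \<phi>) \<le> ev v i"
        "inf (inf (ev v f) (ev v g)) (ev v \<psi>) \<le> ev v j"
        by (simp_all add: inf_inf_le)
      then show "inf (inf (ev v f) (ev v g)) (sup (ev v \<phi>) (ev v \<psi>)) \<le> sup (ev v i) (ev v j)"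
        by (metis inf_sup_distrib1 sup_mono)
    qed
    moreover have "Conj (Conj f g) (Disj \<phi> \<psi>) \<in> F"
      using fg D F(1) by (simp add: fm_filter_Conj_iff)
    ultimately have "Disj i j \<in> F"
      using F(1) fm_filter_mono by blast
    moreover have "Disj i j \<in> I"
      using I fg by (simp add: fm_ideal_def)
    ultimately show False
      using F(3) by blast
  qed
  then show thesis
    by (rule that[OF F])
qed

text \<open>A prime filter assigns one of four values to a formula, according to whether it and its
  negation belong to the filter. Consistency excludes \<open>b\<close>, and the De Morgan laws carry
  the assignment through negated compounds.\<close>

lemma prime_filter_valuation:
  assumes F: "fm_filter F" and "Verum \<in> F" "Falsum \<notin> F"
    and prime: "\<And>\<phi> \<psi>. Disj \<phi> \<psi> \<in> F \<Longrightarrow> \<phi> \<in> F \<or> \<psi> \<in> F"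
    and consistent: "\<And>\<phi>. Conj \<phi> (Neg \<phi>) \<notin> F"
  defines "val \<equiv> (\<lambda>\<phi>. if \<phi> \<in> F then Top4 else if Neg \<phi> \<in> F then Bot4 else N4)"
  shows "ev (\<lambda>x. val (Var x)) \<phi> = val \<phi>"
proof (induction \<phi>)
  have cong: "\<phi> \<in> F \<longleftrightarrow> \<psi> \<in> F" if "\<And>v. ev v \<phi> = ev v \<psi>" for \<phi> \<psi>
    using that fm_filter_mono[OF F] by (metis fm_le_def order_refl)
  have dn: "dm4_neg (dm4_neg a) = a"
    "dm4_neg (inf a b) = sup (dm4_neg a) (dm4_neg b)"
    "dm4_neg (sup a b) = inf (dm4_neg a) (dm4_neg b)" for a b
    by (cases a; cases b; simp add: dm4_ops)+
  have Disj: "Disj \<phi> \<psi> \<in> F \<longleftrightarrow> \<phi> \<in> F \<or> \<psi> \<in> F" for \<phi> \<psi>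
    using prime fm_filter_mono[OF F] by (metis ev_simps(5) fm_le_def sup_ge1 sup_ge2)
  have Conj: "Conj \<phi> \<psi> \<in> F \<longleftrightarrow> \<phi> \<in> F \<and> \<psi> \<in> F" for \<phi> \<psi>
    using fm_filter_Conj_iff[OF F] .
  have NegNeg: "Neg (Neg \<phi>) \<in> F \<longleftrightarrow> \<phi> \<in> F" for \<phi>
    by (rule cong) (simp add: ev_simps dn)
  have NegConj: "Neg (Conj \<phi> \<psi>) \<in> F \<longleftrightarrow> Neg \<phi> \<in> F \<or> Neg \<psi> \<in> F" for \<phi> \<psi>
    unfolding Disj[symmetric] by (rule cong) (simp add: ev_simps dn)
  have NegDisj: "Neg (Disj \<phi> \<psi>) \<in> F \<longleftrightarrow> Neg \<phi> \<in> F \<and> Neg \<psi> \<in> F" for \<phi> \<psi>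
    unfolding Conj[symmetric] by (rule cong) (simp add: ev_simps dn)
  have incons: "\<not> (\<phi> \<in> F \<and> Neg \<phi> \<in> F)" for \<phi>
    using consistent Conj by blast
  {
    case (Var x)
    show ?case by simp
  next
    case Verum
    show ?case using \<open>Verum \<in> F\<close> by (simp add: ev_simps val_def)
  next
    case Falsum
    have "Neg Falsum \<in> F"
      using cong[of "Neg Falsum" Verum] \<open>Verum \<in> F\<close> by (simp add: ev_simps)
    then show ?case using \<open>Falsum \<notin> F\<close> by (simp add: ev_simps val_def)
  next
    case (Neg \<phi>)
    then show ?case
      using incons[of \<phi>] by (auto simp: ev_simps val_def NegNeg)
  next
    case (Conj \<phi> \<psi>)
    then show ?case
      using incons[of \<phi>] incons[of \<psi>] \<open>\<And>\<psi> \<phi>. (Conj \<phi> \<psi> \<in> F) = (\<phi> \<in> F \<and> \<psi> \<in> F)\<close>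
      by (auto simp: ev_simps val_def NegConj dm4_ops)
  next
    case (Disj \<phi> \<psi>)
    then show ?case
      using incons[of \<phi>] incons[of \<psi>] \<open>\<And>\<psi> \<phi>. (Disj \<phi> \<psi> \<in> F) = (\<phi> \<in> F \<or> \<psi> \<in> F)\<close>
      by (auto simp: ev_simps val_def NegDisj dm4_ops)
  }
qed

text \<open>Avoiding \<phi> alone would only give a four-valued countermodel. The ideal to be
  avoided is therefore enlarged by all contradictions, and the assumed rule keeps it disjoint from
  the theory \<open>T\<close>.\<close>

lemma K_subset_if_contradiction_elim:
  assumes L: "is_logic L" "ETL \<subseteq> L" and ce: "contradiction_elim \<in> L"
  shows "K \<subseteq> L"
proof (clarify, rule ccontr)
  fix \<Gamma> \<phi> assume r: "(\<Gamma>, \<phi>) \<in> K" "(\<Gamma>, \<phi>) \<notin> L"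
  define T where "T = {\<psi>. (\<Gamma>, \<psi>) \<in> L}"
  \<comment> \<open>the formulas that may be replaced by \<open>\<phi>\<close> as a disjunct of a member of \<open>T\<close>: this is an
    ideal that contains \<open>\<phi>\<close> and, by the assumed rule, all contradictions\<close>
  define I where "I = {\<psi>. \<forall>\<chi>. Disj \<psi> \<chi> \<in> T \<longrightarrow> Disj \<phi> \<chi> \<in> T}"
  have T_ETL: "\<psi> \<in> T" if "\<Delta> \<subseteq> T" "(\<Delta>, \<psi>) \<in> ETL" for \<Delta> \<psi>
    using logic_derive[OF L, of \<Delta> \<Gamma> \<psi>] that by (auto simp: T_def)
  have T_mono: "\<psi> \<in> T" if "\<chi> \<in> T" "fm_le \<chi> \<psi>" for \<chi> \<psi>
  proof (rule T_ETL)
    have "ev v \<psi> = Top4" if "ev v \<chi> = Top4" for v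
      using \<open>fm_le \<chi> \<psi>\<close> that by (auto simp: fm_le_def less_eq_dm4_def dest: spec[of _ v])
    then show "({\<chi>}, \<psi>) \<in> ETL"
      by (simp add: ETL_iff)
  qed (use that in simp)
  have T: "fm_filter T"
    unfolding fm_filter_def
  proof (intro conjI ballI allI impI)
    fix \<psi> \<chi> assume "\<psi> \<in> T" "\<chi> \<in> T"
    then show "Conj \<psi> \<chi> \<in> T"
      using T_ETL[of "{\<psi>, \<chi>}" "Conj \<psi> \<chi>"] by (simp add: ETL_iff ev_simps dm4_ops)
  qed (fact T_mono)
  have "Verum \<in> T"
    using T_ETL[of "{}"] by (simp add: ETL_iff ev_simps)
  have I: "fm_ideal I"
    unfolding fm_ideal_def
  proof (intro conjI ballI allI impI)
    fix \<psi> \<psi>' assume I: "\<psi> \<in> I" and le: "fm_le \<psi>' \<psi>"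
    have "fm_le (Disj \<psi>' \<chi>) (Disj \<psi> \<chi>)" for \<chi>
      using le by (auto simp: fm_le_def ev_simps intro: sup_mono le_supI1 le_supI2)
    then show "\<psi>' \<in> I"
      using I T_mono by (auto simp: I_def)
  next
    fix \<psi>1 \<psi>2 assume I12: "\<psi>1 \<in> I" "\<psi>2 \<in> I"
    \<comment> \<open>The two disjuncts are replaced one after the other, each time with the rest
      moved into the side formula; hence the quantification over \<chi> in \<open>I\<close>.\<close>
    have "Disj \<phi> \<chi> \<in> T" if "Disj (Disj \<psi>1 \<psi>2) \<chi> \<in> T" for \<chi>
    proof -
      have "Disj \<psi>1 (Disj \<psi>2 \<chi>) \<in> T"
        by (rule T_mono[OF that]) (simp add: fm_le_def ev_simps sup_assoc)
      then have "Disj \<phi> (Disj \<psi>2 \<chi>) \<in> T"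
        using I12(1) by (simp add: I_def)
      then have "Disj \<psi>2 (Disj \<phi> \<chi>) \<in> T"
        by (rule T_mono) (simp add: fm_le_def ev_simps sup_left_commute)
      then have "Disj \<phi> (Disj \<phi> \<chi>) \<in> T"
        using I12(2) by (simp add: I_def)
      then show ?thesis
        by (rule T_mono) (simp add: fm_le_def ev_simps)
    qed
    then show "Disj \<psi>1 \<psi>2 \<in> I"
      by (simp add: I_def)
  qed
  have "\<phi> \<in> I"
    by (simp add: I_def)
  have contr: "Conj \<psi> (Neg \<psi>) \<in> I" for \<psi>
    unfolding I_def mem_Collect_eq
  proof (intro allI impI)
    fix \<chi> assume "Disj (Conj \<psi> (Neg \<psi>)) \<chi> \<in> T"
    moreover have "({Disj (Conj \<psi> (Neg \<psi>)) \<chi>}, \<chi>) \<in> L"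
      using is_logic_subst[OF L(1) ce[unfolded contradiction_elim_def],
          of "\<lambda>x. if x = 0 then \<psi> else \<chi>"] by simp
    ultimately have "\<chi> \<in> T"
      using logic_derive[OF L(1) subset_refl, of "{Disj (Conj \<psi> (Neg \<psi>)) \<chi>}" \<Gamma> \<chi>]
      by (simp add: T_def)
    then show "Disj \<phi> \<chi> \<in> T"
      by (rule T_mono) (simp add: fm_le_def ev_simps)
  qed
  \<comment> \<open>For a common member, the choice of \<phi> as side formula would put
    \<open>Disj \<phi> \<phi>\<close>, and so \<phi>, into \<open>T\<close>.\<close>
  have "T \<inter> I = {}"
  proof (rule ccontr)
    assume "T \<inter> I \<noteq> {}"
    then obtain \<psi> where \<psi>: "\<psi> \<in> T" "\<psi> \<in> I"
      by blast
    have "Disj \<psi> \<phi> \<in> T"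
      by (rule T_mono[OF \<psi>(1)]) (simp add: fm_le_def ev_simps)
    then have "Disj \<phi> \<phi> \<in> T"
      using \<psi>(2) by (simp add: I_def)
    then have "\<phi> \<in> T"
      by (rule T_mono) (simp add: fm_le_def ev_simps)
    then show False
      using r(2) by (simp add: T_def)
  qed
  then obtain F where F: "fm_filter F" "T \<subseteq> F" "F \<inter> I = {}"
    and prime: "\<And>\<psi> \<chi>. Disj \<psi> \<chi> \<in> F \<Longrightarrow> \<psi> \<in> F \<or> \<chi> \<in> F"
    using prime_filter_separation[OF T _ I] \<open>Verum \<in> T\<close> by blast
  define val where "val = (\<lambda>\<psi>. if \<psi> \<in> F then Top4 else if Neg \<psi> \<in> F then Bot4 else N4)"
  have "\<phi> \<notin> F"
    using \<open>\<phi> \<in> I\<close> F(3) by blast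
  then have "Falsum \<notin> F"
    using fm_filter_mono[OF F(1), of Falsum \<phi>] by (auto simp: fm_le_def ev_simps less_eq_dm4_def)
  then have ev: "ev (\<lambda>x. val (Var x)) \<psi> = val \<psi>" for \<psi>
    unfolding val_def
    using F contr prime \<open>Verum \<in> T\<close> by (intro prime_filter_valuation) blast+
  have "(\<Gamma>, \<gamma>) \<in> L" if "\<gamma> \<in> \<Gamma>" for \<gamma>
    using that L(2) by (auto simp: ETL_iff subset_iff)
  then have "\<Gamma> \<subseteq> F"
    using F(2) by (auto simp: T_def)
  then have "\<forall>\<gamma>\<in>\<Gamma>. ev (\<lambda>x. val (Var x)) \<gamma> = Top4"
    unfolding ev by (auto simp: val_def)
  moreover have "\<forall>x. val (Var x) \<noteq> B4"
    by (simp add: val_def)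
  ultimately have "ev (\<lambda>x. val (Var x)) \<phi> = Top4"
    using r(1) by (simp add: K_iff)
  then show False
    using \<open>\<phi> \<notin> F\<close> unfolding ev by (simp add: val_def split: if_splits)
qed

section \<open>The eight-element matrix\<close>

definition proj3 :: "pt set \<Rightarrow> dm4" where
  "proj3 X = (if U \<in> X then Top4 else if U' \<in> X then N4 else Bot4)"

definition proj4 :: "pt set \<Rightarrow> dm4" where
  "proj4 X = (if V \<in> X then if V' \<in> X then Top4 else N4 else if V' \<in> X then B4 else Bot4)"

lemma proj_bounds [simp]:
  "proj3 UNIV = Top4" "proj3 {} = Bot4" "proj4 UNIV = Top4" "proj4 {} = Bot4"
  by (simp_all add: proj3_def proj4_def)

lemma pt_upset_iff:
  "pt_upset X \<longleftrightarrow> (U \<in> X \<longrightarrow> U' \<in> X \<and> V' \<in> X) \<and> (V \<in> X \<longrightarrow> U' \<in> X)"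
  by (auto simp: pt_upset_def pt_less_def)

lemma mem_pt_inv_image: "x \<in> pt_inv ` X \<longleftrightarrow> pt_inv x \<in> X"
proof -
  have "pt_inv (pt_inv y) = y" for y
    by (cases y) simp_all
  then show ?thesis
    by (metis image_iff)
qed

lemma pt_set_eq_UNIV: "X = UNIV \<longleftrightarrow> U \<in> X \<and> V \<in> X \<and> U' \<in> X \<and> V' \<in> X"
proof
  assume X: "U \<in> X \<and> V \<in> X \<and> U' \<in> X \<and> V' \<in> X"
  have "x \<in> X" for x
    using X by (cases x) simp_all
  then show "X = UNIV"
    by blast
qed simp

lemma pt_upset_eval:
  assumes "\<And>x. pt_upset (w x)"
  shows "pt_upset (eval K_minus_matrix w \<phi>)"
  using eval_in_univ[OF subuniverse_K_minus, of w \<phi>] assms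
  by auto

text \<open>Each of the pairs \<open>U, U'\<close> and \<open>V, V'\<close> is closed under the
  involution, so membership there is computed within the pair. For \<open>proj3\<close> this needs
  upsets, in which \<open>U\<close> brings \<open>U'\<close> along.\<close>

lemma ev_proj:
  assumes "\<And>x. pt_upset (w x)"
  shows "ev (\<lambda>x. proj3 (w x)) \<phi> = proj3 (eval K_minus_matrix w \<phi>)"
    and "ev (\<lambda>x. proj4 (w x)) \<phi> = proj4 (eval K_minus_matrix w \<phi>)"
proof -
  have "proj3 (UNIV - pt_inv ` X) = dm4_neg (proj3 X)" if "pt_upset X" for X
    using that by (auto simp: proj3_def pt_upset_iff mem_pt_inv_image)
  moreover have "proj3 (X \<inter> Y) = inf (proj3 X) (proj3 Y)" "proj3 (X \<union> Y) = sup (proj3 X) (proj3 Y)"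
    if "pt_upset X" "pt_upset Y" for X Y
    using that by (auto simp: proj3_def pt_upset_iff dm4_ops)
  ultimately show "ev (\<lambda>x. proj3 (w x)) \<phi> = proj3 (eval K_minus_matrix w \<phi>)"
    by (induction \<phi>) (simp_all add: ev_simps pt_upset_eval[OF assms])
  have "proj4 (UNIV - pt_inv ` X) = dm4_neg (proj4 X)"
    "proj4 (X \<inter> Y) = inf (proj4 X) (proj4 Y)" "proj4 (X \<union> Y) = sup (proj4 X) (proj4 Y)" for X Y
    by (auto simp: proj4_def mem_pt_inv_image dm4_ops)
  then show "ev (\<lambda>x. proj4 (w x)) \<phi> = proj4 (eval K_minus_matrix w \<phi>)"
    by (induction \<phi>) (simp_all add: ev_simps)
qed

lemma upset_eq_UNIV_iff_proj:
  "pt_upset X \<Longrightarrow> X = UNIV \<longleftrightarrow> proj3 X = Top4 \<and> proj4 X = Top4"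
  by (auto simp: proj3_def proj4_def pt_upset_iff pt_set_eq_UNIV)

section \<open>The position of \<open>K_minus\<close> between \<open>ETL\<close> and
  \<open>K\<close>\<close>

lemma ETL_subset_K_minus: "ETL \<subseteq> K_minus"
proof clarify
  fix \<Gamma> \<phi> assume r: "(\<Gamma>, \<phi>) \<in> ETL"
  show "(\<Gamma>, \<phi>) \<in> K_minus"
    unfolding K_minus_iff
  proof (intro allI impI)
    fix w assume "\<forall>x. pt_upset (w x)" and \<Gamma>: "\<forall>\<gamma>\<in>\<Gamma>. eval K_minus_matrix w \<gamma> = UNIV"
    then have w: "\<And>x. pt_upset (w x)"
      by blast
    have "ev (\<lambda>x. proj3 (w x)) \<phi> = Top4" "ev (\<lambda>x. proj4 (w x)) \<phi> = Top4"
      by (rule r[unfolded ETL_iff, rule_format]; simp add: ev_proj[OF w] \<Gamma>)+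
    then show "eval K_minus_matrix w \<phi> = UNIV"
      by (simp add: ev_proj[OF w] upset_eq_UNIV_iff_proj[OF pt_upset_eval[OF w]])
  qed
qed

lemma K_minus_subset_K: "K_minus \<subseteq> K"
proof clarify
  fix \<Gamma> \<phi> assume r: "(\<Gamma>, \<phi>) \<in> K_minus"
  show "(\<Gamma>, \<phi>) \<in> K"
    unfolding K_iff
  proof (intro allI impI)
    fix v :: "nat \<Rightarrow> dm4"
    assume v: "\<forall>x. v x \<noteq> B4" and \<Gamma>: "\<forall>\<gamma>\<in>\<Gamma>. ev v \<gamma> = Top4"
    \<comment> \<open>The upset \<open>{U', V'}\<close> is a fixed point of negation and serves as
      the image of \<open>n\<close>. Giving \<open>B4\<close> the same image keeps
      \<open>emb_neg\<close> free of case restrictions; the lattice equations hold only away from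
      \<open>B4\<close>.\<close>
    define emb where "emb = case_dm4 {} {U', V'} {U', V'} (UNIV :: pt set)"
    have emb_neg: "emb (dm4_neg a) = UNIV - pt_inv ` emb a" for a
    proof -
      have "x \<in> emb (dm4_neg a) \<longleftrightarrow> pt_inv x \<notin> emb a" for x
        by (cases a; cases x) (simp_all add: emb_def)
      then show ?thesis
        unfolding set_eq_iff by (simp add: mem_pt_inv_image)
    qed
    have emb_lattice: "emb (inf a b) = emb a \<inter> emb b" "emb (sup a b) = emb a \<union> emb b"
      if "a \<noteq> B4" "b \<noteq> B4" for a b
      using that by (cases a; cases b; simp add: emb_def dm4_ops)+
    have emb_bounds: "emb Top4 = UNIV" "emb Bot4 = {}"
      by (simp_all add: emb_def)
    have "ev v \<psi> \<noteq> B4" for \<psi>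
    proof (induction \<psi>)
      case (Neg \<psi>)
      then show ?case by (cases "ev v \<psi>") (simp_all add: ev_simps)
    qed (use v in \<open>auto simp: ev_simps dm4_ops\<close>)
    then have ev: "eval K_minus_matrix (\<lambda>x. emb (v x)) \<psi> = emb (ev v \<psi>)" for \<psi>
      by (induction \<psi>) (simp_all add: emb_neg emb_lattice emb_bounds)
    have top: "emb a = UNIV \<longleftrightarrow> a = Top4" for a
      by (cases a) (simp_all add: emb_def pt_set_eq_UNIV)
    have "pt_upset (emb a)" for a
      by (cases a) (simp_all add: emb_def pt_upset_iff)
    then show "ev v \<phi> = Top4"
      using r \<Gamma> unfolding K_minus_iff by (metis ev top)
  qed
qed

text \<open>A contradiction never contains \<open>U\<close>: this would require an upset with
  \<open>U\<close> but without \<open>U'\<close>. So the premise is never the top.\<close>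

lemma explosion2_in_K_minus: "explosion2 \<in> K_minus"
  unfolding explosion2_def K_minus_iff
  by (simp add: pt_set_eq_UNIV mem_pt_inv_image pt_upset_iff) blast

lemma contradiction_elim_notin_K_minus: "contradiction_elim \<notin> K_minus"
proof -
  \<comment> \<open>\<open>{V, U'}\<close> is a fixed point of negation, so it is its own
    contradiction; it contributes exactly the point \<open>V\<close> missing from the other
    upset.\<close>
  define w where "w = (\<lambda>x::nat. if x = 0 then {V, U'} else {U, U', V'})"
  have "pt_upset (w x)" for x
    by (simp add: w_def pt_upset_iff)
  moreover have "eval K_minus_matrix w (Disj (Conj (Var 0) (Neg (Var 0))) (Var 1)) = UNIV"
    "eval K_minus_matrix w (Var 1) \<noteq> UNIV"
    by (simp_all add: pt_set_eq_UNIV w_def)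
  ultimately show ?thesis
    unfolding contradiction_elim_def K_minus_iff by (metis singletonD)
qed

text \<open>The three values form a chain, so a join is the top only if one disjunct is, and a
  contradiction never is.\<close>

lemma contradiction_elim_in_K: "contradiction_elim \<in> K"
proof -
  have "v 1 = Top4"
    if "v 0 \<noteq> B4" "v 1 \<noteq> B4" "ev v (Disj (Conj (Var 0) (Neg (Var 0))) (Var 1)) = Top4" for v
    using that by (cases "v 0"; cases "v 1") (simp_all add: ev_simps dm4_ops)
  then show ?thesis
    by (simp add: contradiction_elim_def K_iff)
qed

lemma contradiction_elim_if_not_subset_K_minus:
  assumes L: "is_logic L" "ETL \<subseteq> L" and "\<not> L \<subseteq> K_minus"
  shows "contradiction_elim \<in> L"
proof (cases "L \<subseteq> K")
  case False
  then show ?thesis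
    by (intro contradiction_elim_if_excluded_middle excluded_middle_if_not_subset_K L)
next
  case True
  obtain \<Gamma> \<phi> where r: "(\<Gamma>, \<phi>) \<in> L" "(\<Gamma>, \<phi>) \<notin> K_minus"
    using assms(3) by auto
  then obtain w where "\<forall>x. pt_upset (w x)"
    and \<Gamma>: "\<And>\<gamma>. \<gamma> \<in> \<Gamma> \<Longrightarrow> eval K_minus_matrix w \<gamma> = UNIV"
    and \<phi>: "eval K_minus_matrix w \<phi> \<noteq> UNIV"
    by (auto simp: K_minus_iff)
  then have w: "\<And>x. pt_upset (w x)"
    by blast
  let ?v3 = "\<lambda>x. proj3 (w x)" and ?v4 = "\<lambda>x. proj4 (w x)"
  have \<Gamma>3: "ev ?v3 \<gamma> = Top4" and \<Gamma>4: "ev ?v4 \<gamma> = Top4" if "\<gamma> \<in> \<Gamma>" for \<gamma>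
    using \<Gamma>[OF that] by (simp_all add: ev_proj[OF w])
  have "\<forall>x. proj3 (w x) \<noteq> B4"
    by (simp add: proj3_def)
  \<comment> \<open>Validity in \<open>K\<close> makes the conclusion exactly true in the
    three-element factor, so the failure is visible in the four-element one.\<close>
  then have "ev ?v3 \<phi> = Top4"
    using subsetD[OF True r(1)] \<Gamma>3 unfolding K_iff by simp
  then have \<phi>4: "ev ?v4 \<phi> \<noteq> Top4"
    using \<phi> upset_eq_UNIV_iff_proj[OF pt_upset_eval[OF w]] by (simp add: ev_proj[OF w])
  \<comment> \<open>\<open>{v, u'}\<close> is named by \<open>p\<close>, \<open>{u, u', v'}\<close> by \<open>q\<close>, the other upsets by
    polynomials in these two\<close>
  define rep where "rep X =
    (if U \<in> X then if V \<in> X then Verum else Var 1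
     else if U' \<in> X then
       if V \<in> X then if V' \<in> X then Disj (Var 0) (Neg (Var 1)) else Var 0
       else if V' \<in> X then Disj (Conj (Neg (Var 0)) (Var 1)) (Neg (Var 1))
       else Conj (Neg (Var 0)) (Var 1)
     else if V' \<in> X then Neg (Var 1) else Falsum)" for X
  define \<sigma> where "\<sigma> = (\<lambda>x. rep (w x))"
  let ?prem = "Disj (Conj (Var 0) (Neg (Var 0))) (Var 1)"
  have cases_g: "g 1 = Top4 \<or> g 0 = N4 \<and> g 1 = B4 \<or> g 0 = B4 \<and> g 1 = N4"
    if "ev g ?prem = Top4" for g
    using that by (cases "g 0"; cases "g 1") (simp_all add: ev_simps dm4_ops)
  have ev_NB: "ev g (subst \<sigma> \<psi>) \<in> {ev ?v4 \<psi>, dm4_swap (ev ?v4 \<psi>)}"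
    if g: "g 0 = N4 \<and> g 1 = B4 \<or> g 0 = B4 \<and> g 1 = N4" for g \<psi>
  proof -
    have "(\<forall>X. pt_upset X \<longrightarrow> ev g (rep X) = proj4 X) \<or>
        (\<forall>X. pt_upset X \<longrightarrow> ev g (rep X) = dm4_swap (proj4 X))"
      using g by (elim disjE conjE)
        (auto simp: rep_def proj4_def pt_upset_iff ev_simps dm4_ops)
    then have "(\<lambda>x. ev g (\<sigma> x)) = ?v4 \<or> (\<lambda>x. ev g (\<sigma> x)) = (\<lambda>x. dm4_swap (?v4 x))"
      using w by (auto simp: \<sigma>_def)
    then show ?thesis
      unfolding eval_subst using ev_swap[of ?v4 \<psi>] by auto
  qed
  \<comment> \<open>With \<open>q\<close> exactly true and \<open>p\<close> arbitrary,
    \<open>rep\<close> names the top on upsets containing \<open>U\<close> and the bottom on those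
    omitting \<open>U'\<close>. On the remaining ones \<open>proj3\<close> is \<open>N4\<close>,
    which allows any value.\<close>
  have ev_Top: "ev g (subst \<sigma> \<psi>) = Top4" if g: "g 1 = Top4" and "ev ?v3 \<psi> = Top4" for g \<psi>
    unfolding eval_subst
  proof (rule ev_Top4_between[where v = ?v3])
    fix x
    show "info_le (?v3 x) (ev g (\<sigma> x))" "info_le (ev g (\<sigma> x)) (dm4_swap (?v3 x))"
      using g w[of x] by (auto simp: \<sigma>_def rep_def proj3_def pt_upset_iff info_le_def ev_simps dm4_ops)
  qed fact
  show ?thesis
    unfolding contradiction_elim_def
  proof (rule logic_derive_subst[OF L r(1), where \<sigma> = \<sigma>])
    fix \<gamma> assume "\<gamma> \<in> \<Gamma>"
    have "ev g (subst \<sigma> \<gamma>) = Top4" if "ev g ?prem = Top4" for g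
      using cases_g[OF that] ev_NB[of g \<gamma>] ev_Top[of g \<gamma>] \<Gamma>3[OF \<open>\<gamma> \<in> \<Gamma>\<close>] \<Gamma>4[OF \<open>\<gamma> \<in> \<Gamma>\<close>]
      by auto
    then show "({?prem}, subst \<sigma> \<gamma>) \<in> ETL"
      by (simp add: ETL_iff)
  next
    have "g 1 = Top4" if "ev g ?prem = Top4" "ev g (subst \<sigma> \<phi>) = Top4" for g
      using cases_g[OF that(1)] ev_NB[of g \<phi>] that(2) \<phi>4 by (auto simp: dm4_swap_eq_Top4)
    then show "({subst \<sigma> \<phi>, ?prem}, Var 1) \<in> ETL"
      by (simp add: ETL_iff)
  qed
qed

section \<open>Strictness of the inclusions and the classification\<close>

lemma explosion2_notin_ETL: "explosion2 \<notin> ETL"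
proof -
  define v :: "nat \<Rightarrow> dm4" where "v = (\<lambda>x. if x = 0 then N4 else if x = 1 then B4 else Bot4)"
  have "ev v (Disj (Conj (Var 0) (Neg (Var 0))) (Conj (Var 1) (Neg (Var 1)))) = Top4"
    "ev v (Var 2) \<noteq> Top4"
    by (simp_all add: v_def ev_simps dm4_ops)
  then show ?thesis
    unfolding explosion2_def ETL_iff by (metis singletonD)
qed

lemma excluded_middle_in_CL: "excluded_middle \<in> CL"
proof -
  have "ev v (Disj (Var 0) (Neg (Var 0))) = Top4" if "v 0 \<in> {Bot4, Top4}" for v
    using that by (auto simp: ev_simps dm4_ops)
  then show ?thesis
    unfolding excluded_middle_def CL_iff by blast
qed

lemma excluded_middle_notin_K: "excluded_middle \<notin> K"
proof -
  have "ev (\<lambda>_. N4) (Disj (Var 0) (Neg (Var 0))) \<noteq> Top4"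
    by (simp add: ev_simps dm4_ops)
  then show ?thesis
    unfolding excluded_middle_def K_iff by (metis dm4.distinct(7) empty_iff)
qed

theorem theorem6p16:
  shows "(\<forall>L. is_logic L \<and> ETL \<subseteq> L \<and> L \<subseteq> CL \<longrightarrow>
            L = ETL \<or> L = K \<or> L = CL \<or> (ETL2 \<subseteq> L \<and> L \<subseteq> K_minus))
         \<and> ETL \<subset> ETL2 \<and> ETL2 \<subseteq> K_minus \<and> K_minus \<subset> K \<and> K \<subset> CL"
proof (intro conjI allI impI)
  have ETL2: "ETL2 = extension ETL {explosion2}"
    by (simp add: ETL2_def explosion2_def)
  fix L assume "is_logic L \<and> ETL \<subseteq> L \<and> L \<subseteq> CL"
  then have L: "is_logic L" "ETL \<subseteq> L" and "L \<subseteq> CL"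
    by blast+
  show "L = ETL \<or> L = K \<or> L = CL \<or> (ETL2 \<subseteq> L \<and> L \<subseteq> K_minus)"
  \<comment> \<open>Inside \<open>K_minus\<close>, exceeding \<open>ETL\<close> forces the rule
    defining \<open>ETL2\<close>. Outside it, \<open>L\<close> contains \<open>K\<close>, and
    exceeding \<open>K\<close> forces all of \<open>CL\<close>.\<close>
  proof (cases "L \<subseteq> K_minus")
    case True
    moreover have "ETL2 \<subseteq> L" if "L \<noteq> ETL"
      unfolding ETL2 using explosion2_if_not_subset_ETL[OF L] that L
      by (intro extension_least) auto
    ultimately show ?thesis
      by blast
  next
    case False
    then have "K \<subseteq> L"
      by (intro K_subset_if_contradiction_elim contradiction_elim_if_not_subset_K_minus L)
    moreover have "CL \<subseteq> L" if "\<not> L \<subseteq> K"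
      using excluded_middle_if_not_subset_K[OF L that] CL_subset_if_excluded_middle[OF L(1)]
        \<open>K \<subseteq> L\<close> by blast
    ultimately show ?thesis
      using \<open>L \<subseteq> CL\<close> by blast
  qed
next
  have ETL2: "ETL2 = extension ETL {explosion2}"
    by (simp add: ETL2_def explosion2_def)
  show "ETL \<subset> ETL2"
    unfolding ETL2 using extension_upper explosion2_notin_ETL by blast
  show "ETL2 \<subseteq> K_minus"
    unfolding ETL2 using ETL_subset_K_minus explosion2_in_K_minus is_logic_Log[OF subuniverse_K_minus]
    by (intro extension_least) (simp_all add: K_minus_def)
  show "K_minus \<subset> K"
    using K_minus_subset_K contradiction_elim_in_K contradiction_elim_notin_K_minus by blast
  show "K \<subset> CL"
    using K_subset_CL excluded_middle_in_CL excluded_middle_notin_K by blast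
qed

end
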